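(* Let $n$ be a positive integer and let $K_n$ be the complete graph on $n$ vertices. (i) The number of vertices of $D_n(K_n)$ is $2^n-1$. (ii) $D_n(K_n)$ is a bipartite graph with parts $X$ and $Y$ satisfying $|X|=2^{n-1}$ and $|Y|=2^{n-1}-1$. (iii) If $n\ge 3$, then the minimum degree of $D_n(K_n)$ is $\delta(D_n(K_n))=n-1$ and the maximum degree is $\Delta(D_n(K_n))=n$. (iv) If $n\ge 3$, then $|E(D_n(K_n))|=n\left(2^{n-1}-1\right)$.
   Context: A set $S\subseteq V(G)$ is a dominating set of a graph $G$ if every vertex of $V(G)\setminus S$ is adjacent to at least one vertex of $S$. The $k$-dominating graph $D_k(G)$ is the graph whose vertices are the dominating sets of $G$ of cardinality at most $k$, two of them being adjacent if and only if one is obtained from the other by adding or deleting a single vertex (i.e. their symmetric difference has exactly one element). When $n=|V(G)|$, the vertices of $D_n(G)$ are all dominating sets of $G$. *)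

theory Defs
  imports "Graph_Theory.Graph_Theory"
begin

text \<open>
  A simple undirected graph is represented as in \<^theory>\<open>Graph_Theory.Digraph\<close>, by a loop-free
  symmetric digraph without parallel arcs (locale \<^locale>\<open>graph\<close>). Each undirected edge is
  therefore a pair of opposite arcs, and the degree of a vertex is its \<^const>\<open>out_degree\<close>.
\<close>

definition dominating_set :: "('a, 'b) pre_digraph \<Rightarrow> 'a set \<Rightarrow> bool" where
  "dominating_set G S \<longleftrightarrow> S \<subseteq> verts G \<and> (\<forall>v \<in> verts G - S. \<exists>u \<in> S. v \<rightarrow>\<^bsub>G\<^esub> u)"

text \<open>
  Finiteness is required explicitly because \<^term>\<open>card S = 0\<close> for infinite \<^term>\<open>S\<close>.
\<close>

definition dominating_sets_upto :: "nat \<Rightarrow> ('a, 'b) pre_digraph \<Rightarrow> 'a set set" where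
  "dominating_sets_upto k G = {S. dominating_set G S \<and> finite S \<and> card S \<le> k}"

definition k_dominating_graph ::
  "nat \<Rightarrow> ('a, 'b) pre_digraph \<Rightarrow> ('a set, 'a set \<times> 'a set) pre_digraph" where
  "k_dominating_graph k G = with_proj
     \<lparr> pverts = dominating_sets_upto k G,
       parcs = {(S, T). S \<in> dominating_sets_upto k G \<and> T \<in> dominating_sets_upto k G
                        \<and> card (sym_diff S T) = 1} \<rparr>"

definition edges :: "('a, 'b) pre_digraph \<Rightarrow> 'a set set" where
  "edges G = {{u, v} | u v. u \<rightarrow>\<^bsub>G\<^esub> v}"

definition min_degree :: "('a, 'b) pre_digraph \<Rightarrow> nat" where
  "min_degree G = Min (out_degree G ` verts G)"

definition max_degree :: "('a, 'b) pre_digraph \<Rightarrow> nat" where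
  "max_degree G = Max (out_degree G ` verts G)"

text \<open>A part may be empty, so that a graph with a single vertex is bipartite.\<close>

definition bipartite_with_parts :: "('a, 'b) pre_digraph \<Rightarrow> 'a set \<Rightarrow> 'a set \<Rightarrow> bool" where
  "bipartite_with_parts G X Y \<longleftrightarrow> graph G \<and> verts G = X \<union> Y \<and> X \<inter> Y = {}
     \<and> arcs_ends G \<subseteq> X \<times> Y \<union> Y \<times> X"

lemma graph_k_dominating_graph:
  assumes "finite (verts G)"
  shows "graph (k_dominating_graph k G)"
proof -
  have fin: "finite (dominating_sets_upto k G)"
    by (rule finite_subset[of _ "Pow (verts G)"])
       (auto simp: dominating_sets_upto_def dominating_set_def assms)
  have "finite {(S, T). S \<in> dominating_sets_upto k G \<and> T \<in> dominating_sets_upto k G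
                        \<and> card (sym_diff S T) = 1}"
    by (rule finite_subset[of _ "dominating_sets_upto k G \<times> dominating_sets_upto k G"])
       (use fin in auto)
  with fin show ?thesis
    unfolding k_dominating_graph_def
    by unfold_locales (auto simp: arc_to_ends_def symmetric_def sym_def Un_commute)
qed

end

theory Submission
  imports Defs
begin

text \<open>
  In a complete graph one vertex already dominates all the others, so the dominating sets are
  exactly the nonempty vertex sets (\<open>dominating_sets_upto_complete\<close>), and \<open>D\<^sub>n(K\<^sub>n)\<close> is the
  \<open>n\<close>-dimensional hypercube of all vertex sets with the corner \<open>{}\<close> removed. Everything else is
  read off from the hypercube.

  Adjacent sets differ by toggling one vertex, which changes the parity of the cardinality; so the
  sets of odd and of even cardinality are the two parts. A hypercube has \<open>2\<^bsup>n-1\<^esup>\<close> corners of either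
  parity, and the missing corner is an even one. Each corner of the hypercube has the \<open>n\<close>
  neighbours got by toggling one of the \<open>n\<close> coordinates, and the missing corner lowers the degree of
  its own neighbours, the singletons, by one. Finally, an edge is determined by the
  toggled vertex \<open>v\<close> and by its smaller end \<open>S\<close>, an arbitrary nonempty set
  avoiding \<open>v\<close>, which gives \<open>n (2\<^bsup>n-1\<^esup> - 1)\<close> edges.
\<close>

section \<open>The graph of dominating sets as a punctured hypercube\<close>

lemma dominating_sets_upto_complete:
  assumes "n \<ge> 1" and "complete_digraph n G"
  shows "dominating_sets_upto n G = Pow (verts G) - {{}}"
proof -
  have card: "card (verts G) = n"
    and ends: "arcs_ends G = {(u, v). (u, v) \<in> verts G \<times> verts G \<and> u \<noteq> v}"
    using assms(2) by (auto simp: complete_digraph_def)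
  with assms(1) have fin: "finite (verts G)" and "verts G \<noteq> {}"
    by (auto intro: card_ge_0_finite)
  \<comment> \<open>The empty set dominates only the empty graph; this is where \<open>n \<ge> 1\<close> is needed.\<close>
  then have "dominating_set G S \<longleftrightarrow> S \<subseteq> verts G \<and> S \<noteq> {}" for S
    unfolding dominating_set_def ends by blast
  with card fin show ?thesis
    by (auto simp: dominating_sets_upto_def intro: finite_subset card_mono)
qed

lemma card_sym_diff_eq_1_iff: "card (sym_diff S T) = 1 \<longleftrightarrow> (\<exists>v. T = sym_diff S {v})"
proof -
  have "sym_diff S T = {v} \<longleftrightarrow> T = sym_diff S {v}" for v
    by blast
  then show ?thesis
    by (simp add: card_1_singleton_iff)
qed

text \<open>
  The graph \<open>D\<^sub>n(K\<^sub>n)\<close> in the form in which all its parameters are computed: an arc leaving \<open>S\<close>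
  is given by the vertex toggled in \<open>S\<close>.
\<close>

lemma k_dominating_graph_complete:
  assumes "n \<ge> 1" and "complete_digraph n G"
  shows "k_dominating_graph n G = with_proj
    \<lparr> pverts = Pow (verts G) - {{}},
      parcs = {(S, sym_diff S {v}) | S v.
        S \<subseteq> verts G \<and> S \<noteq> {} \<and> v \<in> verts G \<and> sym_diff S {v} \<noteq> {}} \<rparr>"
proof -
  have "v \<in> verts G \<longleftrightarrow> sym_diff S {v} \<subseteq> verts G" if "S \<subseteq> verts G" for S v
    using that by blast
  then show ?thesis
    unfolding k_dominating_graph_def dominating_sets_upto_complete[OF assms] card_sym_diff_eq_1_iff
    by (intro arg_cong[where f = with_proj]) (simp, blast)
qed

section \<open>Counting even and odd subsets\<close>

text \<open>
  Toggling a fixed element exchanges the subsets of even and of odd cardinality, so each of the two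
  kinds makes up half of the power set.
\<close>

lemma card_even_odd_subsets:
  assumes "finite A" and "A \<noteq> {}"
  shows "card {S \<in> Pow A. even (card S)} = 2 ^ (card A - 1)"
    and "card {S \<in> Pow A. odd (card S)} = 2 ^ (card A - 1)"
proof -
  have eq: "card {S. S \<subseteq> A \<and> even (card S)} = card {S. S \<subseteq> A \<and> odd (card S)}"
    using card_subsupersets_even_odd[of A "{}"] assms by auto
  have "{S \<in> Pow A. even (card S)} \<union> {S \<in> Pow A. odd (card S)} = Pow A"
    by blast
  then have "card {S \<in> Pow A. even (card S)} + card {S \<in> Pow A. odd (card S)} = 2 ^ card A"
    using assms(1) by (subst card_Un_disjoint[symmetric]) (auto simp: card_Pow)
  moreover have "(2::nat) ^ card A = 2 * 2 ^ (card A - 1)"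
    using assms by (metis card_gt_0_iff power_minus_mult mult.commute)
  ultimately show "card {S \<in> Pow A. even (card S)} = 2 ^ (card A - 1)"
    and "card {S \<in> Pow A. odd (card S)} = 2 ^ (card A - 1)"
    using eq by auto
qed

lemma even_card_toggle:
  assumes "finite S"
  shows "even (card (sym_diff S {v})) \<longleftrightarrow> odd (card S)"
proof (cases "v \<in> S")
  case True
  then have "sym_diff S {v} = S - {v}"
    by blast
  moreover have "card S = Suc (card (S - {v}))"
    using assms True by (rule card.remove)
  ultimately show ?thesis
    by simp
next
  case False
  then have "sym_diff S {v} = insert v S"
    by blast
  with False assms show ?thesis
    by simp
qed

section \<open>Parts, degrees and edges\<close>

lemma k_dominating_graph_complete_bipartite:
  assumes "n \<ge> 1" and "complete_digraph n G"
  shows "bipartite_with_parts (k_dominating_graph n G)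
    {S \<in> Pow (verts G). odd (card S)} ({S \<in> Pow (verts G). even (card S)} - {{}})"
proof -
  have fin: "finite (verts G)"
    using assms by (auto simp: complete_digraph_def intro: card_ge_0_finite)
  then have finS: "finite S" if "S \<subseteq> verts G" for S
    using that by (rule finite_subset[rotated])
  show ?thesis
    unfolding bipartite_with_parts_def
  proof (intro conjI)
    show "graph (k_dominating_graph n G)"
      using fin by (rule graph_k_dominating_graph)
    show "arcs_ends (k_dominating_graph n G)
      \<subseteq> {S \<in> Pow (verts G). odd (card S)} \<times> ({S \<in> Pow (verts G). even (card S)} - {{}})
        \<union> ({S \<in> Pow (verts G). even (card S)} - {{}}) \<times> {S \<in> Pow (verts G). odd (card S)}"
    proof
      fix e
      assume "e \<in> arcs_ends (k_dominating_graph n G)"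
      then obtain S v where e: "e = (S, sym_diff S {v})" and S: "S \<subseteq> verts G" "S \<noteq> {}"
        and v: "v \<in> verts G" "sym_diff S {v} \<noteq> {}"
        by (auto simp: k_dominating_graph_complete[OF assms])
      have "sym_diff S {v} \<in> Pow (verts G)"
        using S v by blast
      moreover have "even (card (sym_diff S {v})) \<longleftrightarrow> odd (card S)"
        using finS[OF S(1)] by (rule even_card_toggle)
      ultimately show "e \<in> {S \<in> Pow (verts G). odd (card S)}
            \<times> ({S \<in> Pow (verts G). even (card S)} - {{}})
          \<union> ({S \<in> Pow (verts G). even (card S)} - {{}}) \<times> {S \<in> Pow (verts G). odd (card S)}"
        unfolding e using S v(2) by (cases "even (card S)") simp_all
    qed
  qed (auto simp: k_dominating_graph_complete[OF assms])
qed

text \<open>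
  The neighbour of \<open>S\<close> obtained by toggling \<open>v\<close> is missing precisely when it is the empty set,
  that is, when \<open>S = {v}\<close>.
\<close>

lemma out_degree_k_dominating_graph_complete:
  assumes "n \<ge> 1" and "complete_digraph n G" and "S \<subseteq> verts G" and "S \<noteq> {}"
  shows "out_degree (k_dominating_graph n G) S = (if card S = 1 then n - 1 else n)"
proof -
  have fin: "finite (verts G)" and card: "card (verts G) = n"
    using assms by (auto simp: complete_digraph_def intro: card_ge_0_finite)
  let ?toggles = "{v \<in> verts G. S \<noteq> {v}}"
  have nonempty: "sym_diff S {v} \<noteq> {} \<longleftrightarrow> S \<noteq> {v}" for v
    by blast
  have "out_arcs (k_dominating_graph n G) S = (\<lambda>v. (S, sym_diff S {v})) ` ?toggles"
    unfolding out_arcs_def k_dominating_graph_complete[OF assms(1,2)] nonempty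
    using assms(3,4) by auto
  moreover have "inj_on (\<lambda>v. (S, sym_diff S {v})) ?toggles"
    by (rule inj_onI) blast
  ultimately have deg: "out_degree (k_dominating_graph n G) S = card ?toggles"
    by (simp add: out_degree_def card_image)
  show ?thesis
  proof (cases "card S = 1")
    case True
    then obtain a where "S = {a}"
      by (auto simp: card_1_singleton_iff)
    then have "?toggles = verts G - {a}" and "a \<in> verts G"
      using assms(3) by auto
    with True deg card show ?thesis
      by simp
  next
    case False
    then have "?toggles = verts G"
      by auto
    with False deg card show ?thesis
      by simp
  qed
qed

text \<open>
  The value \<open>n - 1\<close> is attained at any singleton. For \<open>n \<ge> 2\<close> the full vertex set is not a
  singleton and has degree \<open>n\<close>; for \<open>n = 1\<close> it is, and the degree \<open>n\<close> does not occur.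
\<close>

lemma out_degrees_k_dominating_graph_complete:
  assumes "n \<ge> 2" and "complete_digraph n G"
  shows "out_degree (k_dominating_graph n G) ` verts (k_dominating_graph n G) = {n - 1, n}"
proof -
  have n: "n \<ge> 1" and card: "card (verts G) = n"
    using assms by (auto simp: complete_digraph_def)
  let ?deg = "out_degree (k_dominating_graph n G)"
  have verts: "verts (k_dominating_graph n G) = Pow (verts G) - {{}}"
    by (simp add: k_dominating_graph_complete[OF n assms(2)])
  have deg: "?deg S = (if card S = 1 then n - 1 else n)" if "S \<in> Pow (verts G) - {{}}" for S
    using out_degree_k_dominating_graph_complete[OF n assms(2)] that by simp
  have ne: "verts G \<noteq> {}"
    using n card by auto
  then obtain a where a: "a \<in> verts G"
    by blast
  have "n - 1 = ?deg {a}" and "n = ?deg (verts G)"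
    using a ne card assms(1) by (simp_all add: deg)
  moreover have "{a} \<in> Pow (verts G) - {{}}" and "verts G \<in> Pow (verts G) - {{}}"
    using a ne by auto
  ultimately have "{n - 1, n} \<subseteq> ?deg ` (Pow (verts G) - {{}})"
    by blast
  moreover have "?deg ` (Pow (verts G) - {{}}) \<subseteq> {n - 1, n}"
    using deg by auto
  ultimately show ?thesis
    unfolding verts by blast
qed

text \<open>
  Every edge joins a nonempty set \<open>S\<close> to \<open>insert v S\<close> for some \<open>v \<notin> S\<close>, and the pair \<open>(v, S)\<close> can
  be recovered from the edge. For each of the \<open>n\<close> choices of \<open>v\<close>, the set \<open>S\<close> ranges over the
  nonempty subsets of the other \<open>n - 1\<close> vertices.
\<close>

lemma card_edges_k_dominating_graph_complete:
  assumes "n \<ge> 1" and "complete_digraph n G"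
  shows "card (edges (k_dominating_graph n G)) = n * (2 ^ (n - 1) - 1)"
proof -
  have fin: "finite (verts G)" and card: "card (verts G) = n"
    using assms by (auto simp: complete_digraph_def intro: card_ge_0_finite)
  let ?I = "SIGMA v : verts G. Pow (verts G - {v}) - {{}}"
  let ?edge = "\<lambda>(v, S). {S, insert v S}"
  have "edges (k_dominating_graph n G) = ?edge ` ?I"
  proof
    show "edges (k_dominating_graph n G) \<subseteq> ?edge ` ?I"
    proof
      fix e
      assume "e \<in> edges (k_dominating_graph n G)"
      then obtain S v where e: "e = {S, sym_diff S {v}}" and S: "S \<subseteq> verts G" "S \<noteq> {}"
        and v: "v \<in> verts G" "sym_diff S {v} \<noteq> {}"
        by (auto simp: edges_def k_dominating_graph_complete[OF assms])
      show "e \<in> ?edge ` ?I"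
      proof (cases "v \<in> S")
        case True
        then have "sym_diff S {v} = S - {v}" and "insert v (S - {v}) = S"
          by auto
        with e S v have "e = ?edge (v, S - {v})" and "(v, S - {v}) \<in> ?I"
          by auto
        then show ?thesis
          by (rule image_eqI)
      next
        case False
        then have "sym_diff S {v} = insert v S"
          by auto
        with False e S v have "e = ?edge (v, S)" and "(v, S) \<in> ?I"
          by auto
        then show ?thesis
          by (rule image_eqI)
      qed
    qed
    show "?edge ` ?I \<subseteq> edges (k_dominating_graph n G)"
    proof
      fix e
      assume "e \<in> ?edge ` ?I"
      then obtain v S where e: "e = {S, insert v S}"
        and v: "v \<in> verts G" and S: "S \<subseteq> verts G - {v}" "S \<noteq> {}"
        by auto
      then have ins: "insert v S = sym_diff S {v}"
        by auto
      have "(S, insert v S) \<in> arcs_ends (k_dominating_graph n G)"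
        using v S unfolding ins by (auto simp: k_dominating_graph_complete[OF assms])
      then show "e \<in> edges (k_dominating_graph n G)"
        unfolding e by (auto simp: edges_def)
    qed
  qed
  moreover have "inj_on ?edge ?I"
  proof (rule inj_onI)
    fix p q
    assume "p \<in> ?I" and "q \<in> ?I" and "?edge p = ?edge q"
    then obtain v S w T where pq: "p = (v, S)" "q = (w, T)"
      and S: "S \<subseteq> verts G - {v}" and T: "T \<subseteq> verts G - {w}"
      and eq: "{S, insert v S} = {T, insert w T}"
      by auto
    \<comment> \<open>The smaller end of the edge is the intersection of its ends, and the larger one the union.\<close>
    have "\<Inter>{S, insert v S} = \<Inter>{T, insert w T}" and "\<Union>{S, insert v S} = \<Union>{T, insert w T}"
      by (simp_all only: eq)
    then have "S = T" and "insert v S = insert w T"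
      by auto
    with S T show "p = q"
      unfolding pq by blast
  qed
  ultimately have "card (edges (k_dominating_graph n G)) = card ?I"
    by (simp add: card_image)
  also have "\<dots> = (\<Sum>v\<in>verts G. 2 ^ (n - 1) - 1)"
    using fin card by (simp add: card_SigmaI card_Diff_singleton card_Pow)
  finally show ?thesis
    by (simp add: card)
qed

theorem theorem3:
  fixes n :: nat and G :: "('a, 'b) pre_digraph"
  assumes "n \<ge> 1" and "complete_digraph n G"
  shows "card (verts (k_dominating_graph n G)) = 2 ^ n - 1
    \<and> (\<exists>X Y. bipartite_with_parts (k_dominating_graph n G) X Y
          \<and> card X = 2 ^ (n - 1) \<and> card Y = 2 ^ (n - 1) - 1)
    \<and> (n \<ge> 3 \<longrightarrow> min_degree (k_dominating_graph n G) = n - 1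
          \<and> max_degree (k_dominating_graph n G) = n)
    \<and> (n \<ge> 3 \<longrightarrow> card (edges (k_dominating_graph n G)) = n * (2 ^ (n - 1) - 1))"
proof (intro conjI impI)
  have fin: "finite (verts G)" and card: "card (verts G) = n" and ne: "verts G \<noteq> {}"
    using assms by (auto simp: complete_digraph_def intro: card_ge_0_finite)
  show "card (verts (k_dominating_graph n G)) = 2 ^ n - 1"
    using fin card
    by (simp add: k_dominating_graph_complete[OF assms] card_Diff_singleton card_Pow)
  have "card ({S \<in> Pow (verts G). even (card S)} - {{}}) = 2 ^ (n - 1) - 1"
    using card_even_odd_subsets(1)[OF fin ne] card by (subst card_Diff_singleton) auto
  then show "\<exists>X Y. bipartite_with_parts (k_dominating_graph n G) X Y
      \<and> card X = 2 ^ (n - 1) \<and> card Y = 2 ^ (n - 1) - 1"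
    using k_dominating_graph_complete_bipartite[OF assms] card_even_odd_subsets(2)[OF fin ne] card
    by blast
next
  assume "n \<ge> 3"
  then have "n \<ge> 2"
    by simp
  note degrees = out_degrees_k_dominating_graph_complete[OF this assms(2)]
  show "min_degree (k_dominating_graph n G) = n - 1"
    unfolding min_degree_def degrees by simp
  show "max_degree (k_dominating_graph n G) = n"
    unfolding max_degree_def degrees by simp
next
  show "card (edges (k_dominating_graph n G)) = n * (2 ^ (n - 1) - 1)"
    by (rule card_edges_k_dominating_graph_complete[OF assms])
qed

end
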